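(* Let $x,y\in\Omega$ and $0\le t\le 1$. The Cholesky-Vinberg path $\gamma^{\mathrm{cv}}_{x,y}$ has the following properties. (i) Endpoints and reversal: $\gamma^{\mathrm{cv}}_{x,y}(0)=x$, $\gamma^{\mathrm{cv}}_{x,y}(1)=y$, and $\gamma^{\mathrm{cv}}_{y,x}(t)=\gamma^{\mathrm{cv}}_{x,y}(1-t)$. In particular $x\,\#_{\mathrm{cv}}\,y=y\,\#_{\mathrm{cv}}\,x$. (ii) Positive homogeneity: for all $\lambda,\mu>0$, $\gamma^{\mathrm{cv}}_{\lambda x,\mu y}(t)=\lambda^{1-t}\mu^{t}\,\gamma^{\mathrm{cv}}_{x,y}(t)$. Hence $(\lambda x)\,\#_{\mathrm{cv}}\,(\mu y)=\sqrt{\lambda\mu}\,(x\,\#_{\mathrm{cv}}\,y)$. (iii) $H$-equivariance: for all $h\in H$, $\gamma^{\mathrm{cv}}_{hxh^{\top},hyh^{\top}}(t)=h\,\gamma^{\mathrm{cv}}_{x,y}(t)\,h^{\top}$. In particular $(hxh^{\top})\,\#_{\mathrm{cv}}\,(hyh^{\top})=h(x\,\#_{\mathrm{cv}}\,y)h^{\top}$. (iv) Determinant interpolation: $\det\gamma^{\mathrm{cv}}_{x,y}(t)=\det(x)^{1-t}\det(y)^{t}$. In particular $\det(x\,\#_{\mathrm{cv}}\,y)=\sqrt{\det x\,\det y}$.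
   Context: Let $V\subset \mathrm{Sym}(3,\mathbb{R})$ be the 5-dimensional space of real symmetric $3\times3$ matrices whose $(1,2)$ and $(2,1)$ entries are $0$, and let $\Omega\subset V$ be the open cone of positive definite matrices in $V$ (the Vinberg cone). Let $H$ be the group of real lower triangular $3\times 3$ matrices with positive diagonal entries and zero $(2,1)$ entry. The map $\Phi:H\to\Omega$, $\Phi(T)=TT^{\top}$, is a diffeomorphism; for $x\in\Omega$, $T_x:=\Phi^{-1}(x)\in H$ is the lower Cholesky factor of $x$. For $T\in H$ and $t\in\mathbb{R}$, $T^t:=\exp(t\log T)\in H$, where $\log$ is the principal matrix logarithm. For $x,y\in\Omega$ and $0\le t\le1$ the Cholesky-Vinberg path is $\gamma^{\mathrm{cv}}_{x,y}(t):=\Phi\bigl(T_x(T_x^{-1}T_y)^t\bigr)$, and the Cholesky-Vinberg mean is $x\,\#_{\mathrm{cv}}\,y:=\gamma^{\mathrm{cv}}_{x,y}(1/2)$. *)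

theory Defs
  imports "HOL-Analysis.Analysis"
begin

(* The distribution's power operation on the type of vectors is componentwise, so the matrix
   powers in the exponential series are written as iterated matrix products. *)
definition matrix_exp :: "real^'n^'n \<Rightarrow> real^'n^'n" where
  "matrix_exp A = (\<Sum>k. (1 / fact k) *\<^sub>R (((**) A ^^ k) (mat 1)))"

definition complex_eigenvalue :: "real^'n^'n \<Rightarrow> complex \<Rightarrow> bool" where
  "complex_eigenvalue A z \<longleftrightarrow> (\<exists>v. v \<noteq> 0 \<and> map_matrix complex_of_real A *v v = z *s v)"

(* The principal logarithm of a matrix without eigenvalues on the closed negative real axis is
   its unique logarithm with all eigenvalues in the open strip |Im z| < pi; it is real when the
   matrix is real, so it suffices to look among real matrices.  The value is meaningless for
   matrices that do have eigenvalues on the closed negative real axis. *)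
definition principal_log :: "real^'n^'n \<Rightarrow> real^'n^'n" where
  "principal_log A =
     (THE X. matrix_exp X = A \<and> (\<forall>z. complex_eigenvalue X z \<longrightarrow> \<bar>Im z\<bar> < pi))"

definition positive_definite :: "real^'n^'n \<Rightarrow> bool" where
  "positive_definite A \<longleftrightarrow> transpose A = A \<and> (\<forall>v. v \<noteq> 0 \<longrightarrow> 0 < v \<bullet> (A *v v))"

definition vinberg_space :: "(real^3^3) set" where
  "vinberg_space = {A. transpose A = A \<and> A $ 1 $ 2 = 0 \<and> A $ 2 $ 1 = 0}"

definition vinberg_cone :: "(real^3^3) set" where
  "vinberg_cone = {A \<in> vinberg_space. positive_definite A}"

(* Triangularity is written out entrywise: in the index type 3 one has 3 = 0, so its built-in
   order does not enumerate the indices as 1 < 2 < 3. *)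
definition vinberg_group :: "(real^3^3) set" where
  "vinberg_group =
     {T. T $ 1 $ 2 = 0 \<and> T $ 1 $ 3 = 0 \<and> T $ 2 $ 3 = 0 \<and> T $ 2 $ 1 = 0 \<and> (\<forall>i. 0 < T $ i $ i)}"

definition cholesky_map :: "real^3^3 \<Rightarrow> real^3^3" where
  "cholesky_map T = T ** transpose T"

definition cholesky_factor :: "real^3^3 \<Rightarrow> real^3^3" where
  "cholesky_factor = inv_into vinberg_group cholesky_map"

definition matrix_rpow :: "real^'n^'n \<Rightarrow> real \<Rightarrow> real^'n^'n" where
  "matrix_rpow T t = matrix_exp (t *\<^sub>R principal_log T)"

definition cv_path :: "real^3^3 \<Rightarrow> real^3^3 \<Rightarrow> real \<Rightarrow> real^3^3" where
  "cv_path x y t =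
     cholesky_map
       (cholesky_factor x ** matrix_rpow (matrix_inv (cholesky_factor x) ** cholesky_factor y) t)"

definition cv_mean :: "real^3^3 \<Rightarrow> real^3^3 \<Rightarrow> real^3^3" where
  "cv_mean x y = cv_path x y (1 / 2)"

end

theory Submission
  imports Defs "HOL-Computational_Algebra.Fundamental_Theorem_Algebra"
begin

text \<open>
  Every element of the group \<open>H\<close> is \<open>exp Y\<close> for a matrix \<open>Y\<close> of the same lower triangular shape,
  and \<open>Y\<close> is its principal logarithm. Hence, writing \<open>x = \<Phi>(S)\<close> and \<open>y = \<Phi>(S exp Y)\<close>, the path is
  \<open>t \<mapsto> \<Phi>(S exp(tY))\<close>, from which all properties are read off: reversal exchanges \<open>(S, Y)\<close> for
  \<open>(S exp Y, -Y)\<close>, scaling adds a multiple of the identity to \<open>Y\<close>, and \<open>h\<close> acts by \<open>S \<mapsto> hS\<close>.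

  The point that needs an argument is that \<open>Y\<close> is the only real logarithm \<open>X\<close> with spectrum in the
  strip \<open>\<bar>Im z\<bar> < \<pi>\<close>. For real \<open>b\<close> the operator \<open>Q\<^sub>b = (exp X - exp b) / (X - b)\<close> is injective. If
  \<open>Y v = b v + u e\<close> and \<open>X e = Y e = c e\<close>, then comparing \<open>(exp X) v\<close> with \<open>(exp Y) v\<close> gives
  \<open>Q\<^sub>b ((X - b) v) = Q\<^sub>b (u e)\<close>, hence \<open>X v = Y v\<close>. This determines \<open>X\<close> on the standard basis,
  starting with the last basis vector.
\<close>

subsection \<open>Exponential series of bounded operators\<close>

text \<open>Stated for arbitrary operators so that matrices acting on vectors, left multiplication
  of matrices and multiplication of complex numbers share one series and can be compared through
  intertwining maps.\<close>

definition linear_exp :: "('a::real_normed_vector \<Rightarrow> 'a) \<Rightarrow> 'a \<Rightarrow> 'a" where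
  "linear_exp f w = (\<Sum>k. (1 / fact k) *\<^sub>R (f ^^ k) w)"

text \<open>\<open>pow_quotient f b w k\<close> is \<open>(f\<^sup>k - b\<^sup>k) / (f - b)\<close> applied to \<open>w\<close>, so that \<open>exp_quotient f b\<close>
  is the operator \<open>(exp f - exp b) / (f - b)\<close>, where \<open>z \<mapsto> (exp z - exp b) / (z - b)\<close> is continued to \<open>z = b\<close>.\<close>

primrec pow_quotient :: "('a::real_normed_vector \<Rightarrow> 'a) \<Rightarrow> real \<Rightarrow> 'a \<Rightarrow> nat \<Rightarrow> 'a" where
  "pow_quotient f b w 0 = 0"
| "pow_quotient f b w (Suc k) = b ^ k *\<^sub>R w + f (pow_quotient f b w k)"

definition exp_quotient :: "('a::real_normed_vector \<Rightarrow> 'a) \<Rightarrow> real \<Rightarrow> 'a \<Rightarrow> 'a" where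
  "exp_quotient f b w = (\<Sum>k. (1 / fact k) *\<^sub>R pow_quotient f b w k)"

lemma summable_linear_exp:
  fixes f :: "'a::banach \<Rightarrow> 'a"
  assumes "bounded_linear f"
  shows "summable (\<lambda>k. (1 / fact k) *\<^sub>R (f ^^ k) w)"
proof -
  obtain K where K: "K \<ge> 0" "\<And>x. norm (f x) \<le> norm x * K"
    using bounded_linear.nonneg_bounded[OF assms] by blast
  have bound: "norm ((f ^^ k) w) \<le> norm w * K ^ k" for k
  proof (induction k)
    case (Suc k)
    have "norm (f ((f ^^ k) w)) \<le> norm ((f ^^ k) w) * K" by (rule K)
    also have "\<dots> \<le> (norm w * K ^ k) * K" using Suc K by (intro mult_right_mono)
    finally show ?case by (simp add: mult_ac)
  qed simp
  have "summable (\<lambda>k. norm w * (inverse (fact k) * K ^ k))"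
    by (intro summable_mult summable_exp)
  then show ?thesis
    using bound by (rule_tac summable_comparison_test') (auto simp: field_simps)
qed

lemma summable_exp_quotient:
  fixes f :: "'a::banach \<Rightarrow> 'a"
  assumes "bounded_linear f"
  shows "summable (\<lambda>k. (1 / fact k) *\<^sub>R pow_quotient f b w k)"
proof -
  obtain K0 where K0: "K0 \<ge> 0" "\<And>x. norm (f x) \<le> norm x * K0"
    using bounded_linear.nonneg_bounded[OF assms] by blast
  define K where "K = max K0 \<bar>b\<bar>"
  have K: "K \<ge> 0" "\<bar>b\<bar> \<le> K" "\<And>x. norm (f x) \<le> norm x * K"
    using K0(1) unfolding K_def
    by (auto intro: order_trans[OF K0(2) mult_left_mono])
  \<comment> \<open>Unfolded at \<open>Suc k\<close>, the quotient is a sum of \<open>Suc k\<close>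
    terms, each of norm at most \<open>norm w * K ^ k\<close>. The factor \<open>Suc k\<close> is
    absorbed by the factorial below.\<close>
  have bound: "norm (pow_quotient f b w (Suc k)) \<le> real (Suc k) * (norm w * K ^ k)" for k
  proof (induction k)
    case 0
    then show ?case using assms by (simp add: linear_simps)
  next
    case (Suc k)
    have "norm (pow_quotient f b w (Suc (Suc k)))
        \<le> \<bar>b\<bar> ^ Suc k * norm w + norm (f (pow_quotient f b w (Suc k)))"
      unfolding pow_quotient.simps(2)[of f b w "Suc k"]
      by (rule order_trans[OF norm_triangle_ineq]) (simp add: power_abs abs_mult)
    also have "\<dots> \<le> K ^ Suc k * norm w + (real (Suc k) * (norm w * K ^ k)) * K"
      using K Suc by (intro add_mono mult_right_mono power_mono order_trans[OF K(3)]) auto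
    finally show ?case by (simp add: algebra_simps)
  qed
  have "summable (\<lambda>k. norm w * (inverse (fact k) * K ^ k))"
    by (intro summable_mult summable_exp)
  moreover have "norm ((1 / fact (Suc k)) *\<^sub>R pow_quotient f b w (Suc k))
      \<le> norm w * (inverse (fact k) * K ^ k)" for k
  proof -
    have "norm ((1 / fact (Suc k)) *\<^sub>R pow_quotient f b w (Suc k))
        \<le> (1 / fact (Suc k)) * (real (Suc k) * (norm w * K ^ k))"
      unfolding norm_scaleR using bound[of k] by (intro mult_mono) auto
    also have "\<dots> = norm w * (inverse (fact k) * K ^ k)"
      by (simp add: field_simps del: of_nat_Suc)
    finally show ?thesis .
  qed
  ultimately have "summable (\<lambda>k. (1 / fact (Suc k)) *\<^sub>R pow_quotient f b w (Suc k))"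
    by (rule summable_comparison_test'[where N = 0])
  then show ?thesis by (subst (asm) summable_Suc_iff)
qed

lemma linear_exp_intertwine:
  fixes f :: "'a::banach \<Rightarrow> 'a" and g :: "'b::banach \<Rightarrow> 'b"
  assumes f: "bounded_linear f" and L: "bounded_linear L" and fg: "\<And>x. L (f x) = g (L x)"
  shows "L (linear_exp f w) = linear_exp g (L w)"
proof -
  have "L ((f ^^ k) w) = (g ^^ k) (L w)" for k by (induction k) (auto simp: fg)
  then show ?thesis
    unfolding linear_exp_def bounded_linear.suminf[OF L summable_linear_exp[OF f]]
    using L by (simp add: linear_simps)
qed

text \<open>Transports the quotient operator along complexification, scalar multiplication, the
  operator itself, and the embedding of scalars as a line of eigenvectors.\<close>

lemma exp_quotient_intertwine:
  fixes f :: "'a::banach \<Rightarrow> 'a" and g :: "'b::banach \<Rightarrow> 'b"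
  assumes f: "bounded_linear f" and L: "bounded_linear L" and fg: "\<And>x. L (f x) = g (L x)"
  shows "L (exp_quotient f b w) = exp_quotient g b (L w)"
proof -
  have "L (pow_quotient f b w k) = pow_quotient g b (L w) k" for k
    using L by (induction k) (auto simp: fg linear_simps)
  then show ?thesis
    unfolding exp_quotient_def bounded_linear.suminf[OF L summable_exp_quotient[OF f]]
    using L by (simp add: linear_simps)
qed

lemma exp_quotient_diff:
  fixes f :: "'a::banach \<Rightarrow> 'a"
  assumes f: "bounded_linear f"
  shows "exp_quotient f b (v - w) = exp_quotient f b v - exp_quotient f b w"
proof -
  have "pow_quotient f b (v - w) k = pow_quotient f b v k - pow_quotient f b w k" for k
    by (induction k) (simp_all add: scaleR_diff_right linear_simps[OF f])
  then show ?thesis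
    unfolding exp_quotient_def
    by (simp add: suminf_diff[OF summable_exp_quotient summable_exp_quotient] f scaleR_diff_right)
qed

lemma linear_exp_scaleR:
  fixes w :: "'a::banach"
  shows "linear_exp ((*\<^sub>R) b) w = exp b *\<^sub>R w"
proof -
  have "((*\<^sub>R) b ^^ k) w = b ^ k *\<^sub>R w" for k by (induction k) auto
  moreover have "(\<lambda>k. (1 / fact k) * b ^ k) sums exp b"
    using exp_converges[of b] by (simp add: field_simps)
  then have "(\<lambda>k. ((1 / fact k) * b ^ k) *\<^sub>R w) sums (exp b *\<^sub>R w)"
    by (rule bounded_linear.sums[OF bounded_linear_scaleR_left])
  ultimately show ?thesis by (simp add: linear_exp_def sums_iff)
qed

text \<open>Termwise this is the factorization of \<open>f^k - b^k\<close> as the quotient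
  polynomial composed with \<open>f - b\<close>.\<close>

lemma linear_exp_eq_exp_quotient:
  fixes f :: "'a::banach \<Rightarrow> 'a"
  assumes f: "bounded_linear f"
  shows "linear_exp f w = exp b *\<^sub>R w + exp_quotient f b (f w - b *\<^sub>R w)"
proof -
  have f_pow: "f (pow_quotient f b v k) = pow_quotient f b (f v) k" for v k
    using f by (induction k) (auto simp: linear_simps)
  have telescope: "(f ^^ k) w - ((*\<^sub>R) b ^^ k) w = pow_quotient f b (f w - b *\<^sub>R w) k" for k
  proof (induction k)
    case (Suc k)
    have "((*\<^sub>R) b ^^ k) w = b ^ k *\<^sub>R w" by (induction k) auto
    then show ?case
      using f Suc by (auto simp: linear_simps algebra_simps simp flip: Suc)
  qed simp
  have "linear_exp f w - linear_exp ((*\<^sub>R) b) w = exp_quotient f b (f w - b *\<^sub>R w)"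
    unfolding linear_exp_def exp_quotient_def
    by (subst suminf_diff)
      (auto intro!: summable_linear_exp f bounded_linear_scaleR_right
        simp flip: telescope simp: scaleR_diff_right)
  then show ?thesis by (simp add: linear_exp_scaleR algebra_simps)
qed

lemma linear_exp_mult:
  fixes z :: "'a::{real_normed_field,banach}"
  shows "linear_exp ((*) z) 1 = exp z"
proof -
  have "((*) z ^^ k) 1 = z ^ k" for k by (induction k) auto
  then show ?thesis by (simp add: linear_exp_def exp_def divide_inverse_commute)
qed

lemma exp_quotient_mult:
  fixes z :: "'a::{real_normed_field,banach}"
  shows "exp_quotient ((*) z) b 1 =
    (if z = of_real b then exp z else (exp z - exp (of_real b)) / (z - of_real b))"
proof (cases "z = of_real b")
  case True
  \<comment> \<open>At \<open>z = b\<close> the quotient polynomial degenerates to the derivative of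
    the power function, whose exponential series is again that of \<open>exp\<close>.\<close>
  have "pow_quotient ((*) z) b 1 (Suc k) = of_nat (Suc k) * z ^ k" for k
    by (induction k) (auto simp: True scaleR_conv_of_real algebra_simps)
  then have *: "(1 / fact (Suc k)) *\<^sub>R pow_quotient ((*) z) b 1 (Suc k) = z ^ k /\<^sub>R fact k" for k
    by (simp add: scaleR_conv_of_real field_simps del: of_nat_Suc pow_quotient.simps)
  have "exp_quotient ((*) z) b 1 = (\<Sum>k. (1 / fact (Suc k)) *\<^sub>R pow_quotient ((*) z) b 1 (Suc k))"
    unfolding exp_quotient_def
    by (subst suminf_split_head) (auto intro: summable_exp_quotient bounded_linear_mult_right)
  then show ?thesis unfolding * using True by (simp add: exp_def)
next
  case False
  have "exp z = exp (of_real b) + exp_quotient ((*) z) b (z - of_real b)"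
    using linear_exp_eq_exp_quotient[OF bounded_linear_mult_right, of z 1 b]
    by (simp add: linear_exp_mult scaleR_conv_of_real exp_of_real)
  also have "exp_quotient ((*) z) b (z - of_real b) = (z - of_real b) * exp_quotient ((*) z) b 1"
    using exp_quotient_intertwine[OF bounded_linear_mult_right bounded_linear_mult_right,
        of "z - of_real b" z "(*) z" b 1, OF mult.left_commute] by simp
  finally show ?thesis using False by (simp add: field_simps)
qed

section \<open>Eigenvectors in invariant subspaces and injectivity of the quotient operator\<close>

text \<open>Take a nonzero polynomial \<open>p\<close> of least degree with
  \<open>p(B) w = 0\<close> and a complex root \<open>z\<close> of it. If
  \<open>p = (X - z) q\<close>, then \<open>q(B) w\<close> is an eigenvector for
  \<open>z\<close>.\<close>

lemma eigenvector_in_invariant_subspace: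
  fixes B :: "complex^'n^'n"
  assumes N: "vec.subspace N" and inv: "\<And>v. v \<in> N \<Longrightarrow> B *v v \<in> N"
    and w: "w \<in> N" "w \<noteq> 0"
  obtains z v where "v \<in> N" "v \<noteq> 0" "B *v v = z *s v"
proof -
  define iter where "iter i = (((*v) B) ^^ i) w" for i
  define app where "app p = (\<Sum>i\<le>degree p. coeff p i *s iter i)" for p
  have iter_Suc: "B *v iter i = iter (Suc i)" for i by (simp add: iter_def)
  have iter_N: "iter i \<in> N" for i
    unfolding iter_def by (induction i) (auto intro: inv w)
  have app_N: "app p \<in> N" for p
    unfolding app_def by (intro vec.subspace_sum[OF N] vec.subspace_scale[OF N] iter_N)
  have app_eq: "app p = (\<Sum>i\<le>n. coeff p i *s iter i)" if "degree p \<le> n" for p n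
    unfolding app_def using that
    by (intro sum.mono_neutral_left) (auto simp: coeff_eq_0)
  \<comment> \<open>Linear dependence is a statement about the set of iterates. If the first
    \<open>CARD('n) + 1\<close> of them are distinct, their number exceeds the dimension; if two
    coincide, the difference of two monomials annihilates \<open>w\<close>.\<close>
  have "\<exists>p. p \<noteq> 0 \<and> app p = 0"
  proof (cases "inj_on iter {..CARD('n)}")
    case True
    have "vec.dependent (iter ` {..CARD('n)})"
    proof (rule ccontr)
      assume "\<not> vec.dependent (iter ` {..CARD('n)})"
      then have "card (iter ` {..CARD('n)}) \<le> vec.dim (UNIV :: (complex^'n) set)"
        by (intro vec.independent_card_le_dim) auto
      then show False using True unfolding vec_dim_card by (simp add: card_image)
    qed
    then obtain u where u: "\<exists>v\<in>iter ` {..CARD('n)}. u v \<noteq> 0"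
      "(\<Sum>v\<in>iter ` {..CARD('n)}. u v *s v) = 0"
      by (auto simp: vec.dependent_finite)
    define p where "p = Poly (map (\<lambda>i. u (iter i)) [0..<Suc CARD('n)])"
    have coeff: "coeff p i = (if i \<le> CARD('n) then u (iter i) else 0)" for i
      by (auto simp: p_def nth_default_def less_Suc_eq_le simp del: upt_Suc)
    have "degree p \<le> CARD('n)" by (rule degree_le) (auto simp: coeff)
    then have "app p = 0"
      using u(2) True by (simp add: app_eq coeff sum.reindex)
    moreover have "p \<noteq> 0" using u(1) coeff by (metis atMost_iff coeff_0 imageE)
    ultimately show ?thesis by blast
  next
    case False
    then obtain i j where "i \<noteq> j" "iter i = iter j" by (auto simp: inj_on_def)
    define p where "p = monom (1::complex) i - monom 1 j"
    have "degree p \<le> max i j"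
      unfolding p_def by (intro degree_diff_le_max[THEN order_trans] max.mono degree_monom_le)
    then have "app p = (\<Sum>k\<le>max i j. coeff p k *s iter k)" by (rule app_eq)
    also have "\<dots> = (\<Sum>k\<le>max i j. (if k = i then iter i else 0) - (if k = j then iter j else 0))"
      by (intro sum.cong) (auto simp: p_def)
    also have "\<dots> = 0"
      using \<open>iter i = iter j\<close> by (simp add: sum_subtractf)
    finally have "app p = 0" .
    moreover have "p \<noteq> 0"
      using \<open>i \<noteq> j\<close> by (auto simp: p_def poly_eq_iff dest!: spec[of _ i])
    ultimately show ?thesis by blast
  qed
  then obtain p where p: "p \<noteq> 0" "app p = 0"
    and minimal: "\<And>q. q \<noteq> 0 \<Longrightarrow> degree q < degree p \<Longrightarrow> app q \<noteq> 0"
    using ex_has_least_nat[of "\<lambda>p. p \<noteq> 0 \<and> app p = 0" _ degree] by (metis not_less)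
  have "degree p \<noteq> 0"
  proof
    assume "degree p = 0"
    then obtain c where "p = [:c:]" by (rule degree_eq_zeroE)
    then show False using p w by (simp add: app_def iter_def)
  qed
  then have "\<not> constant (poly p)" by (simp add: constant_degree)
  then obtain z where "poly p z = 0" using fundamental_theorem_of_algebra by blast
  then obtain q where q: "p = [:-z, 1:] * q" by (auto simp: poly_eq_0_iff_dvd)
  then have "q \<noteq> 0" using p by auto
  then have deg: "degree p = Suc (degree q)" unfolding q by (subst degree_mult_eq) auto
  \<comment> \<open>Multiplication by the variable shifts coefficients, which corresponds to
    applying \<open>B\<close>. The top term of the second sum vanishes because its index exceeds the
    degree of \<open>q\<close>.\<close>
  have "app p = B *v app q - z *s app q"
  proof -
    have coeff_p: "coeff p i = coeff (pCons 0 q) i - z * coeff q i" for i by (simp add: q)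
    have "app p = (\<Sum>i\<le>Suc (degree q). coeff (pCons 0 q) i *s iter i)
        - (\<Sum>i\<le>Suc (degree q). (z * coeff q i) *s iter i)"
      unfolding app_def deg coeff_p vector_sub_rdistrib sum_subtractf ..
    also have "(\<Sum>i\<le>Suc (degree q). coeff (pCons 0 q) i *s iter i)
        = (\<Sum>i\<le>degree q. coeff q i *s iter (Suc i))"
      by (subst sum.atMost_Suc_shift) simp
    also have "\<dots> = B *v app q"
      by (simp add: app_def vec.sum vec.scale iter_Suc)
    also have "(\<Sum>i\<le>Suc (degree q). (z * coeff q i) *s iter i) = z *s app q"
      by (simp add: app_def vec.scale_sum_right coeff_eq_0)
    finally show ?thesis .
  qed
  then have "B *v app q = z *s app q" using p by simp
  moreover have "app q \<noteq> 0" using minimal \<open>q \<noteq> 0\<close> deg by simp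
  ultimately show thesis using that app_N by blast
qed

lemma bounded_linear_complexify:
  "bounded_linear (\<lambda>v::real^'n. (\<chi> i. complex_of_real (v $ i)))"
  by (intro linear_conv_bounded_linear[THEN iffD1] linearI)
    (auto simp: vec_eq_iff scaleR_conv_of_real[where 'a = complex])

lemma bounded_linear_scale_vector: "bounded_linear (\<lambda>z. z *s (v :: complex^'n))"
  by (intro linear_conv_bounded_linear[THEN iffD1] linearI)
    (auto simp: vec_eq_iff algebra_simps)

lemma bounded_linear_vector_scale: "bounded_linear (\<lambda>v :: complex^'n. z *s v)"
  by (intro linear_conv_bounded_linear[THEN iffD1] linearI)
    (auto simp: vec_eq_iff algebra_simps)

text \<open>Since \<open>b\<close> is real, \<open>z\<close> and \<open>b\<close> have imaginary
  parts less than \<open>2 * pi\<close> apart, so \<open>exp\<close> separates them; at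
  \<open>z = b\<close> the value is \<open>exp z\<close>.\<close>

lemma exp_quotient_mult_nonzero:
  assumes "\<bar>Im z\<bar> < pi"
  shows "exp_quotient ((*) z) b 1 \<noteq> 0"
proof (cases "z = of_real b")
  case False
  have "exp z \<noteq> exp (of_real b)"
  proof
    assume eq: "exp z = exp (complex_of_real b)"
    have "\<bar>Im z - Im (complex_of_real b)\<bar> < 2 * pi"
      using assms pi_gt_zero by simp
    from exp_complex_eqI[OF this eq] False show False by blast
  qed
  with False show ?thesis by (simp add: exp_quotient_mult)
qed (simp add: exp_quotient_mult)

text \<open>The complexified kernel is invariant under \<open>X\<close>, so it would contain an eigenvector; but
  \<open>(exp z - exp b) / (z - b)\<close> has no zero in the strip.\<close>

lemma inj_exp_quotient:
  fixes X :: "real^'n^'n"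
  assumes strip: "\<forall>z. complex_eigenvalue X z \<longrightarrow> \<bar>Im z\<bar> < pi"
    and eq: "exp_quotient ((*v) X) b v = exp_quotient ((*v) X) b w"
  shows "v = w"
proof (rule ccontr)
  assume "v \<noteq> w"
  define B where "B = map_matrix complex_of_real X"
  define cx where "cx v = (\<chi> i. complex_of_real (v $ i))" for v :: "real^'n"
  define Psi where "Psi = exp_quotient ((*v) B) b"
  have B: "bounded_linear ((*v) B)" by simp
  have cx: "bounded_linear cx" unfolding cx_def by (rule bounded_linear_complexify)
  have scale: "Psi (z *s v) = z *s Psi v" for z v
    unfolding Psi_def
    by (rule exp_quotient_intertwine[OF B bounded_linear_vector_scale, symmetric])
      (simp add: vec.scale)
  have "cx (X *v x) = B *v cx x" for x
    by (simp add: cx_def B_def vec_eq_iff matrix_vector_mult_def map_matrix_def)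
  then have "Psi (cx (v - w)) = cx (exp_quotient ((*v) X) b (v - w))"
    unfolding Psi_def by (intro exp_quotient_intertwine[OF _ cx, symmetric]) auto
  also have "\<dots> = 0" using eq cx by (simp add: exp_quotient_diff linear_simps)
  finally have kernel: "cx (v - w) \<in> {u. Psi u = 0}" by simp
  have nonzero: "cx (v - w) \<noteq> 0"
    using \<open>v \<noteq> w\<close> by (auto simp: cx_def vec_eq_iff)
  have diff: "Psi (u - u') = Psi u - Psi u'" for u u'
    unfolding Psi_def by (rule exp_quotient_diff[OF B])
  have "Psi 0 = 0" using diff[of 0 0] by simp
  \<comment> \<open>Additivity, required for a subspace, is recovered from compatibility with
    differences.\<close>
  moreover from this have "Psi (- u) = - Psi u" for u using diff[of 0 u] by simp
  then have "Psi (u + u') = Psi u + Psi u'" for u u' using diff[of u "- u'"] by simp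
  ultimately have sub: "vec.subspace {u. Psi u = 0}"
    by (auto simp: vec.subspace_def scale)
  have inv: "B *v u \<in> {u. Psi u = 0}" if "u \<in> {u. Psi u = 0}" for u
    using that exp_quotient_intertwine[OF B B, of "(*v) B" b u] by (simp add: Psi_def)
  obtain z u where u: "Psi u = 0" "u \<noteq> 0" "B *v u = z *s u"
    using eigenvector_in_invariant_subspace[OF sub inv kernel nonzero] by blast
  \<comment> \<open>The map \<open>\<lambda>s. s *s u\<close> intertwines multiplication by
    \<open>z\<close> with \<open>B\<close>, so \<open>Psi\<close> acts on \<open>u\<close> as the
    scalar quotient at \<open>z\<close>.\<close>
  have "exp_quotient ((*) z) b 1 *s u = Psi (1 *s u)"
    unfolding Psi_def
    by (rule exp_quotient_intertwine[OF bounded_linear_mult_right bounded_linear_scale_vector])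
      (simp add: u vec.scale mult.commute)
  moreover have "complex_eigenvalue X z"
    using u by (auto simp: complex_eigenvalue_def B_def)
  ultimately show False
    using u exp_quotient_mult_nonzero strip by (auto simp: vector_mul_eq_0)
qed

text \<open>The matrix series is the exponential of left multiplication by \<open>A\<close> at the
  identity; evaluation at \<open>w\<close> intertwines that operator with \<open>A\<close> acting on
  vectors.\<close>

lemma matrix_exp_mult_vector: "matrix_exp A *v w = linear_exp ((*v) A) w"
proof -
  have L: "bounded_linear (\<lambda>M::real^'a^'a. M *v w)"
    by (intro linear_conv_bounded_linear[THEN iffD1] linearI)
      (auto simp: matrix_vector_mult_add_rdistrib scaleR_matrix_vector_assoc)
  have A: "bounded_linear ((**) A)"
    by (intro linear_conv_bounded_linear[THEN iffD1] linearI)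
      (auto simp: distrib_left sum.distrib vec_eq_iff matrix_matrix_mult_def
        sum_distrib_left mult_ac)
  have "matrix_exp A *v w = linear_exp ((**) A) (mat 1) *v w"
    by (simp only: matrix_exp_def linear_exp_def)
  also have "\<dots> = linear_exp ((*v) A) (mat 1 *v w)"
    by (rule linear_exp_intertwine[OF A L, where g = "(*v) A"])
      (simp add: matrix_vector_mul_assoc)
  finally show ?thesis by simp
qed

subsection \<open>Lower triangular matrices and their logarithms\<close>

text \<open>One parametrization serves both the group, where the diagonal is positive, and the
  logarithms, where it is arbitrary.\<close>

definition vinberg_matrix :: "real \<Rightarrow> real \<Rightarrow> real \<Rightarrow> real \<Rightarrow> real \<Rightarrow> real^3^3" where
  "vinberg_matrix a b c p q = vector [vector [a, 0, 0], vector [0, b, 0], vector [p, q, c]]"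

lemma vinberg_matrix_nth [simp]:
  "vinberg_matrix a b c p q $ 1 = vector [a, 0, 0]"
  "vinberg_matrix a b c p q $ 2 = vector [0, b, 0]"
  "vinberg_matrix a b c p q $ 3 = vector [p, q, c]"
  by (simp_all add: vinberg_matrix_def)

lemma vinberg_matrix_mult:
  "vinberg_matrix a b c p q ** vinberg_matrix a' b' c' p' q' =
    vinberg_matrix (a * a') (b * b') (c * c') (p * a' + c * p') (q * b' + c * q')"
  by (simp add: vec_eq_iff forall_3 matrix_matrix_mult_def sum_3)

lemma vinberg_matrix_scaleR:
  "r *\<^sub>R vinberg_matrix a b c p q = vinberg_matrix (r * a) (r * b) (r * c) (r * p) (r * q)"
  by (simp add: vec_eq_iff forall_3)

lemma vinberg_matrix_one: "vinberg_matrix 1 1 1 0 0 = mat 1"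
  by (simp add: vec_eq_iff forall_3 mat_def)

lemma det_vinberg_matrix: "det (vinberg_matrix a b c p q) = a * b * c"
  by (simp add: det_3)

lemma vinberg_group_iff:
  "T \<in> vinberg_group \<longleftrightarrow> (\<exists>a b c p q. T = vinberg_matrix a b c p q \<and> 0 < a \<and> 0 < b \<and> 0 < c)"
proof
  assume "T \<in> vinberg_group"
  then have "T = vinberg_matrix (T$1$1) (T$2$2) (T$3$3) (T$3$1) (T$3$2) \<and>
      0 < T$1$1 \<and> 0 < T$2$2 \<and> 0 < T$3$3"
    by (auto simp: vinberg_group_def vec_eq_iff forall_3)
  then show "\<exists>a b c p q. T = vinberg_matrix a b c p q \<and> 0 < a \<and> 0 < b \<and> 0 < c" by blast
qed (auto simp: vinberg_group_def forall_3)

lemma vinberg_group_mult: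
  assumes "S \<in> vinberg_group" "T \<in> vinberg_group"
  shows "S ** T \<in> vinberg_group"
proof -
  obtain a b c p q a' b' c' p' q' where
    "S = vinberg_matrix a b c p q" "0 < a" "0 < b" "0 < c"
    "T = vinberg_matrix a' b' c' p' q'" "0 < a'" "0 < b'" "0 < c'"
    using assms unfolding vinberg_group_iff by blast
  then show ?thesis
    unfolding vinberg_group_iff by (auto simp: vinberg_matrix_mult intro!: exI)
qed

lemma vinberg_group_scaleR: "T \<in> vinberg_group \<Longrightarrow> 0 < r \<Longrightarrow> r *\<^sub>R T \<in> vinberg_group"
  by (simp add: vinberg_group_def)

lemma vinberg_group_right_inverse:
  assumes "S \<in> vinberg_group"
  obtains R where "R \<in> vinberg_group" "S ** R = mat 1"
proof -
  obtain a b c p q where S: "S = vinberg_matrix a b c p q" "0 < a" "0 < b" "0 < c"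
    using assms unfolding vinberg_group_iff by blast
  define R where "R = vinberg_matrix (1 / a) (1 / b) (1 / c) (- p / (a * c)) (- q / (b * c))"
  have "R \<in> vinberg_group" using S by (simp add: R_def vinberg_group_def forall_3)
  moreover have "S ** R = mat 1"
    using S by (simp add: R_def vinberg_matrix_mult flip: vinberg_matrix_one)
  ultimately show thesis using that by blast
qed

lemma vinberg_group_divide:
  assumes "S \<in> vinberg_group" "T \<in> vinberg_group"
  obtains A where "A \<in> vinberg_group" "T = S ** A"
proof -
  obtain R where "R \<in> vinberg_group" "S ** R = mat 1"
    using vinberg_group_right_inverse[OF assms(1)] .
  then show thesis
    using that[of "R ** T"] vinberg_group_mult assms(2) by (simp add: matrix_mul_assoc)
qed

lemma matrix_inv_mult_cancel:
  assumes "S \<in> vinberg_group"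
  shows "matrix_inv S ** (S ** A) = A"
proof -
  obtain R where R: "S ** R = mat 1" using vinberg_group_right_inverse[OF assms] .
  then have "R ** S = mat 1" by (simp add: matrix_left_right_inverse)
  \<comment> \<open>\<open>matrix_inv\<close> is a choice, so \<open>R\<close> is needed as a
    witness that a two-sided inverse exists.\<close>
  with R have "matrix_inv S ** S = mat 1"
    unfolding matrix_inv_def by - (rule someI2[of _ R], auto)
  then show ?thesis by (simp add: matrix_mul_assoc)
qed

section \<open>Exponentials of triangular matrices via divided differences of the exponential
  function\<close>

text \<open>The first divided difference of \<open>exp\<close>, continued by the derivative on the
  diagonal; it is the value of the quotient operator on an eigenvector.\<close>

definition exp_slope :: "real \<Rightarrow> real \<Rightarrow> real" where
  "exp_slope c b = (if c = b then exp c else (exp c - exp b) / (c - b))"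

lemma exp_slope_nonzero: "exp_slope c b \<noteq> 0"
  by (simp add: exp_slope_def)

text \<open>With the factor \<open>t\<close> included, the case distinction depends on
  \<open>c = b\<close> alone, and \<open>t = 0\<close> needs no separate treatment.\<close>

lemma scaled_exp_slope:
  "t * exp_slope (t * c) (t * b) =
    (if c = b then t * exp (t * c) else (exp (t * c) - exp (t * b)) / (c - b))"
  by (auto simp: exp_slope_def field_simps)

lemma exp_slope_add: "exp_slope (c + r) (b + r) = exp r * exp_slope c b"
  by (simp add: exp_slope_def exp_add algebra_simps)

lemma exp_quotient_eigenvector:
  fixes X :: "real^'n^'n"
  assumes "X *v e = c *\<^sub>R e"
  shows "exp_quotient ((*v) X) b (u *\<^sub>R e) = (u * exp_slope c b) *\<^sub>R e"
proof -
  have "exp_quotient ((*) c) b 1 *\<^sub>R (u *\<^sub>R e) = exp_quotient ((*v) X) b (1 *\<^sub>R (u *\<^sub>R e))"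
    by (rule exp_quotient_intertwine[OF bounded_linear_mult_right bounded_linear_scaleR_left])
      (simp add: assms matrix_vector_mult_scaleR mult_ac)
  then show ?thesis by (simp add: exp_quotient_mult exp_slope_def mult.commute split: if_splits)
qed

lemma matrix_exp_triangular:
  fixes X :: "real^'n^'n"
  assumes "X *v e = c *\<^sub>R e" and "X *v v = b *\<^sub>R v + u *\<^sub>R e"
  shows "matrix_exp X *v v = exp b *\<^sub>R v + (u * exp_slope c b) *\<^sub>R e"
proof -
  have "linear_exp ((*v) X) v = exp b *\<^sub>R v + exp_quotient ((*v) X) b (X *v v - b *\<^sub>R v)"
    by (rule linear_exp_eq_exp_quotient) simp
  with assms show ?thesis by (simp add: matrix_exp_mult_vector exp_quotient_eigenvector)
qed

text \<open>Converse of \<open>matrix_exp_triangular\<close>: injectivity of the quotient operator,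
  guaranteed by the strip condition, allows it to be cancelled.\<close>

lemma matrix_exp_triangularD:
  fixes X :: "real^'n^'n"
  assumes strip: "\<forall>z. complex_eigenvalue X z \<longrightarrow> \<bar>Im z\<bar> < pi"
    and e: "X *v e = c *\<^sub>R e"
    and v: "matrix_exp X *v v = exp b *\<^sub>R v + (u * exp_slope c b) *\<^sub>R e"
  shows "X *v v = b *\<^sub>R v + u *\<^sub>R e"
proof -
  have "linear_exp ((*v) X) v = exp b *\<^sub>R v + exp_quotient ((*v) X) b (X *v v - b *\<^sub>R v)"
    by (rule linear_exp_eq_exp_quotient) simp
  then have "exp_quotient ((*v) X) b (X *v v - b *\<^sub>R v) = exp_quotient ((*v) X) b (u *\<^sub>R e)"
    using v by (simp add: matrix_exp_mult_vector exp_quotient_eigenvector[OF e])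
  then have "X *v v - b *\<^sub>R v = u *\<^sub>R e" by (rule inj_exp_quotient[OF strip])
  then show ?thesis by (simp add: algebra_simps)
qed

lemma matrix_exp_zero: "matrix_exp (0 :: real^'n^'n) = mat 1"
  using matrix_exp_triangular[of "0 :: real^'n^'n" 0 0 _ 0 0] by (simp add: matrix_eq)

lemma matrix_eq_axis:
  fixes A B :: "'a::semiring_1^'n^'m"
  assumes "\<And>j. A *v axis j 1 = B *v axis j 1"
  shows "A = B"
proof -
  have "M $ i $ j = (M *v axis j 1) $ i" for M :: "'a^'n^'m" and i j
    by (simp add: matrix_vector_mult_def axis_def if_distrib[of "\<lambda>x. _ * x"] cong: if_cong)
  with assms show ?thesis by (simp add: vec_eq_iff)
qed

lemma vinberg_matrix_mult_axis:
  "vinberg_matrix a b c p q *v axis 1 1 = a *\<^sub>R axis 1 1 + p *\<^sub>R axis 3 1"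
  "vinberg_matrix a b c p q *v axis 2 1 = b *\<^sub>R axis 2 1 + q *\<^sub>R axis 3 1"
  "vinberg_matrix a b c p q *v axis 3 1 = c *\<^sub>R axis 3 1"
  by (simp_all add: vec_eq_iff forall_3 matrix_vector_mult_def sum_3 axis_def)

lemma matrix_exp_vinberg_matrix:
  "matrix_exp (vinberg_matrix a b c p q) =
    vinberg_matrix (exp a) (exp b) (exp c) (p * exp_slope c a) (q * exp_slope c b)"
    (is "matrix_exp ?X = ?Y")
proof (rule matrix_eq_axis)
  fix j :: 3
  note e = vinberg_matrix_mult_axis(3)[of a b c p q]
  have "matrix_exp ?X *v axis 1 1 = ?Y *v axis 1 1"
    using matrix_exp_triangular[OF e vinberg_matrix_mult_axis(1)]
    by (simp add: vinberg_matrix_mult_axis)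
  moreover have "matrix_exp ?X *v axis 2 1 = ?Y *v axis 2 1"
    using matrix_exp_triangular[OF e vinberg_matrix_mult_axis(2)]
    by (simp add: vinberg_matrix_mult_axis)
  moreover have "matrix_exp ?X *v axis 3 1 = ?Y *v axis 3 1"
    using matrix_exp_triangular[OF e, of "axis 3 1" c 0]
    by (simp add: vinberg_matrix_mult_axis)
  ultimately show "matrix_exp ?X *v axis j 1 = ?Y *v axis j 1"
    using exhaust_3[of j] by auto
qed

lemma complex_eigenvalue_vinberg_matrix:
  assumes "complex_eigenvalue (vinberg_matrix a b c p q) z"
  shows "Im z = 0"
proof -
  obtain v where v: "v \<noteq> 0"
    "map_matrix complex_of_real (vinberg_matrix a b c p q) *v v = z *s v"
    using assms by (auto simp: complex_eigenvalue_def)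
  then have "a * v $ 1 = z * v $ 1" "b * v $ 2 = z * v $ 2"
    "p * v $ 1 + q * v $ 2 + c * v $ 3 = z * v $ 3" and "v $ 1 \<noteq> 0 \<or> v $ 2 \<noteq> 0 \<or> v $ 3 \<noteq> 0"
    by (simp_all add: vec_eq_iff forall_3 map_matrix_def matrix_vector_mult_def sum_3)
  \<comment> \<open>If \<open>z\<close> differs from \<open>a\<close> and \<open>b\<close>, the
    first two coordinates vanish, and the third row forces \<open>z = c\<close>.\<close>
  then have "z = a \<or> z = b \<or> z = c" by auto
  then show ?thesis by auto
qed

section \<open>Principal logarithms and one-parameter subgroups\<close>

text \<open>A competing logarithm is not assumed triangular. Its third column is found first because
  it supplies the eigenvector for the other two.\<close>

lemma principal_log_matrix_exp_vinberg_matrix: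
  "principal_log (matrix_exp (vinberg_matrix a b c p q)) = vinberg_matrix a b c p q"
    (is "principal_log (matrix_exp ?Y) = ?Y")
  unfolding principal_log_def
proof (rule the_equality)
  show "matrix_exp ?Y = matrix_exp ?Y \<and> (\<forall>z. complex_eigenvalue ?Y z \<longrightarrow> \<bar>Im z\<bar> < pi)"
    using complex_eigenvalue_vinberg_matrix by (auto simp: pi_gt_zero)
next
  fix X
  assume X: "matrix_exp X = matrix_exp ?Y \<and> (\<forall>z. complex_eigenvalue X z \<longrightarrow> \<bar>Im z\<bar> < pi)"
  then have strip: "\<forall>z. complex_eigenvalue X z \<longrightarrow> \<bar>Im z\<bar> < pi" ..
  have exp_X: "matrix_exp X =
      vinberg_matrix (exp a) (exp b) (exp c) (p * exp_slope c a) (q * exp_slope c b)"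
    using X by (simp add: matrix_exp_vinberg_matrix)
  \<comment> \<open>No eigenvector of \<open>X\<close> is known yet, so the auxiliary vector is
    taken to be 0.\<close>
  have col3: "X *v axis 3 1 = c *\<^sub>R axis 3 1"
    using matrix_exp_triangularD[OF strip, where e = 0 and v = "axis 3 1" and b = c]
    by (simp add: exp_X vinberg_matrix_mult_axis)
  have "X *v axis 1 1 = a *\<^sub>R axis 1 1 + p *\<^sub>R axis 3 1"
    by (rule matrix_exp_triangularD[OF strip col3]) (auto simp: exp_X vinberg_matrix_mult_axis)
  moreover have "X *v axis 2 1 = b *\<^sub>R axis 2 1 + q *\<^sub>R axis 3 1"
    by (rule matrix_exp_triangularD[OF strip col3]) (auto simp: exp_X vinberg_matrix_mult_axis)
  ultimately have "X *v axis j 1 = ?Y *v axis j 1" for j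
    using exhaust_3[of j] col3 by (auto simp: vinberg_matrix_mult_axis)
  then show "X = ?Y" by (rule matrix_eq_axis)
qed

lemma vinberg_group_exp:
  assumes "T \<in> vinberg_group"
  obtains a b c p q where "T = matrix_exp (vinberg_matrix a b c p q)"
proof -
  obtain a b c p q where T: "T = vinberg_matrix a b c p q" "0 < a" "0 < b" "0 < c"
    using assms unfolding vinberg_group_iff by blast
  \<comment> \<open>The closed form of the exponential is solved entrywise; the off-diagonal
    division is legitimate because a divided difference of \<open>exp\<close> never
    vanishes.\<close>
  then have "T = matrix_exp (vinberg_matrix (ln a) (ln b) (ln c)
      (p / exp_slope (ln c) (ln a)) (q / exp_slope (ln c) (ln b)))"
    by (simp add: matrix_exp_vinberg_matrix exp_slope_nonzero)
  then show thesis using that by blast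
qed

lemma matrix_exp_in_vinberg_group: "matrix_exp (vinberg_matrix a b c p q) \<in> vinberg_group"
  unfolding matrix_exp_vinberg_matrix vinberg_group_iff by (intro exI conjI) auto

lemma matrix_exp_scaleR_add:
  "matrix_exp (s *\<^sub>R vinberg_matrix a b c p q) ** matrix_exp (t *\<^sub>R vinberg_matrix a b c p q) =
    matrix_exp ((s + t) *\<^sub>R vinberg_matrix a b c p q)"
proof -
  \<comment> \<open>This is the identity for the two off-diagonal entries, to be used with
    \<open>d = a\<close> and \<open>d = b\<close>. For distinct \<open>c\<close> and
    \<open>d\<close> the numerators telescope.\<close>
  have slope: "s * exp_slope (s * c) (s * d) * exp (t * d)
        + exp (s * c) * (t * exp_slope (t * c) (t * d))
      = (s + t) * exp_slope ((s + t) * c) ((s + t) * d)" for d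
  proof (cases "c = d")
    case False
    have "(exp (s * c) - exp (s * d)) * exp (t * d) + exp (s * c) * (exp (t * c) - exp (t * d))
        = exp ((s + t) * c) - exp ((s + t) * d)"
      by (simp add: distrib_right exp_add algebra_simps)
    with False show ?thesis
      unfolding scaled_exp_slope by (simp flip: add_divide_distrib)
  next
    case True
    have "s * exp (s * d) * exp (t * d) + exp (s * d) * (t * exp (t * d))
        = (s + t) * exp ((s + t) * d)"
      by (simp add: exp_add algebra_simps)
    with True show ?thesis unfolding scaled_exp_slope by simp
  qed
  show ?thesis
    using arg_cong[OF slope, of "(*) p" a] arg_cong[OF slope, of "(*) q" b]
    by (simp add: vinberg_matrix_scaleR matrix_exp_vinberg_matrix vinberg_matrix_mult
        exp_add algebra_simps)
qed

lemma matrix_exp_add_scalar: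
  "matrix_exp (vinberg_matrix (a + r) (b + r) (c + r) p q) =
    exp r *\<^sub>R matrix_exp (vinberg_matrix a b c p q)"
  by (simp add: matrix_exp_vinberg_matrix vinberg_matrix_scaleR exp_slope_add exp_add mult_ac)

subsection \<open>The Cholesky-Vinberg path\<close>

lemma cholesky_map_vinberg_matrix:
  "cholesky_map (vinberg_matrix a b c p q) =
    vector [vector [a\<^sup>2, 0, a * p], vector [0, b\<^sup>2, b * q],
            vector [a * p, b * q, p\<^sup>2 + q\<^sup>2 + c\<^sup>2]]"
  by (simp add: cholesky_map_def vec_eq_iff forall_3 matrix_matrix_mult_def sum_3 transpose_def
      power2_eq_square mult_ac)

text \<open>Positivity recovers \<open>a\<close> and \<open>b\<close> from their squares,
  cancellation then gives \<open>p\<close> and \<open>q\<close>, and the last diagonal entry yields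
  \<open>c\<close>.\<close>

lemma cholesky_map_inj: "inj_on cholesky_map vinberg_group"
proof (rule inj_onI)
  fix S T
  assume "S \<in> vinberg_group" "T \<in> vinberg_group" and eq: "cholesky_map S = cholesky_map T"
  then obtain a b c p q a' b' c' p' q' where
    S: "S = vinberg_matrix a b c p q" "0 < a" "0 < b" "0 < c" and
    T: "T = vinberg_matrix a' b' c' p' q'" "0 < a'" "0 < b'" "0 < c'"
    unfolding vinberg_group_iff by blast
  have "a\<^sup>2 = a'\<^sup>2" "b\<^sup>2 = b'\<^sup>2" "a * p = a' * p'" "b * q = b' * q'"
    "p\<^sup>2 + q\<^sup>2 + c\<^sup>2 = p'\<^sup>2 + q'\<^sup>2 + c'\<^sup>2"
    using eq unfolding S T cholesky_map_vinberg_matrix by (simp_all add: vec_eq_iff forall_3)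
  then show "S = T" using S T by (auto simp: power2_eq_iff_nonneg less_imp_le)
qed

lemma cholesky_factor_cholesky_map: "T \<in> vinberg_group \<Longrightarrow> cholesky_factor (cholesky_map T) = T"
  unfolding cholesky_factor_def by (rule inv_into_f_f[OF cholesky_map_inj])

lemma vinberg_cone_cholesky:
  assumes "x \<in> vinberg_cone"
  obtains T where "T \<in> vinberg_group" "x = cholesky_map T"
proof -
  define a b d e f where "a = x$1$1" "b = x$2$2" "d = x$3$3" "e = x$3$1" "f = x$3$2"
  note defs = this
  have pos: "v \<bullet> (x *v v) > 0" if "v \<noteq> 0" for v
    using assms that by (auto simp: vinberg_cone_def positive_definite_def)
  have sym: "transpose x = x" and zero: "x$1$2 = 0" "x$2$1 = 0"
    using assms by (auto simp: vinberg_cone_def vinberg_space_def)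
  have "x$i$j = x$j$i" for i j
    using arg_cong[OF sym, of "\<lambda>M. M$j$i"] by (simp add: transpose_def)
  from this[of 1 3] this[of 2 3] zero
  have x: "x = vector [vector [a, 0, e], vector [0, b, f], vector [e, f, d]]"
    by (simp add: vec_eq_iff forall_3 defs)
  have quad: "v \<bullet> (x *v v) = a * (v$1)\<^sup>2 + b * (v$2)\<^sup>2 + d * (v$3)\<^sup>2
      + 2 * e * v$1 * v$3 + 2 * f * v$2 * v$3" for v
    by (simp add: x inner_vec_def matrix_vector_mult_def sum_3 power2_eq_square algebra_simps)
  have axis_nth_3: "axis i (1::real) $ j = (if j = i then 1 else 0)" for i j :: 3
    by (auto simp: axis_def)
  have a: "a > 0" using pos[of "axis 1 1", unfolded quad] by (simp add: axis_nth_3)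
  have b: "b > 0" using pos[of "axis 2 1", unfolded quad] by (simp add: axis_nth_3)
  \<comment> \<open>This vector minimizes the quadratic form among those with third coordinate 1.
    The minimum is the Schur complement, the square of the last diagonal entry of the Cholesky
    factor.\<close>
  have "vector [- e / a, - f / b, 1] \<noteq> (0 :: real^3)" by (simp add: vec_eq_iff forall_3)
  from pos[OF this]
  have "0 < a * (- e / a)\<^sup>2 + b * (- f / b)\<^sup>2 + d + 2 * e * (- e / a) + 2 * f * (- f / b)"
    by (simp add: quad)
  also have "\<dots> = d - e\<^sup>2 / a - f\<^sup>2 / b"
    using a b by (simp add: power2_eq_square field_simps)
  finally have schur: "d - e\<^sup>2 / a - f\<^sup>2 / b > 0" .
  define T where "T = vinberg_matrix (sqrt a) (sqrt b) (sqrt (d - e\<^sup>2 / a - f\<^sup>2 / b))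
      (e / sqrt a) (f / sqrt b)"
  have "T \<in> vinberg_group"
    using a b schur by (simp add: T_def vinberg_group_def forall_3)
  moreover have "x = cholesky_map T"
    using a b schur by (simp add: x T_def cholesky_map_vinberg_matrix power_divide)
  ultimately show thesis using that by blast
qed

lemma cholesky_map_mult: "cholesky_map (h ** T) = h ** cholesky_map T ** transpose h"
  by (simp add: cholesky_map_def matrix_transpose_mul matrix_mul_assoc)

lemma cholesky_map_scaleR: "cholesky_map (r *\<^sub>R T) = r\<^sup>2 *\<^sub>R cholesky_map T"
  by (simp add: cholesky_map_def vec_eq_iff matrix_matrix_mult_def transpose_def
      sum_distrib_left power2_eq_square mult_ac)

lemma det_cholesky_map: "det (cholesky_map T) = (det T)\<^sup>2"
  by (simp add: cholesky_map_def det_mul power2_eq_square)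

section \<open>Closed form of the path and its properties\<close>

text \<open>The Cholesky factors differ by the right factor \<open>exp Y\<close>, whose principal
  logarithm is \<open>Y\<close>, so the power in the path is \<open>exp(tY)\<close>.\<close>

lemma cv_path_exp:
  assumes "S \<in> vinberg_group"
  shows "cv_path (cholesky_map S) (cholesky_map (S ** matrix_exp (vinberg_matrix a b c p q))) t =
    cholesky_map (S ** matrix_exp (t *\<^sub>R vinberg_matrix a b c p q))"
  using assms
  by (simp add: cv_path_def cholesky_factor_cholesky_map vinberg_group_mult
      matrix_exp_in_vinberg_group matrix_inv_mult_cancel matrix_rpow_def
      principal_log_matrix_exp_vinberg_matrix)

lemma vinberg_cone_pairE:
  assumes "x \<in> vinberg_cone" "y \<in> vinberg_cone"
  obtains S a b c p q where "S \<in> vinberg_group" "x = cholesky_map S"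
    "y = cholesky_map (S ** matrix_exp (vinberg_matrix a b c p q))"
  by (metis assms vinberg_cone_cholesky vinberg_group_divide vinberg_group_exp)

lemma cv_path_endpoints:
  assumes "x \<in> vinberg_cone" "y \<in> vinberg_cone"
  shows "cv_path x y 0 = x" "cv_path x y 1 = y"
proof -
  obtain S a b c p q where S: "S \<in> vinberg_group" "x = cholesky_map S"
    "y = cholesky_map (S ** matrix_exp (vinberg_matrix a b c p q))"
    using vinberg_cone_pairE[OF assms] .
  show "cv_path x y 0 = x" "cv_path x y 1 = y"
    unfolding S cv_path_exp[OF S(1)] by (simp_all add: matrix_exp_zero)
qed

lemma cv_path_reverse:
  assumes "x \<in> vinberg_cone" "y \<in> vinberg_cone"
  shows "cv_path y x t = cv_path x y (1 - t)"
proof -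
  obtain S a b c p q where S: "S \<in> vinberg_group" "x = cholesky_map S"
    "y = cholesky_map (S ** matrix_exp (vinberg_matrix a b c p q))"
    using vinberg_cone_pairE[OF assms] .
  define T where "T = S ** matrix_exp (vinberg_matrix a b c p q)"
  \<comment> \<open>Seen from the other endpoint \<open>T\<close>, the same curve runs in direction
    \<open>-Y\<close>; time 1 leads back to \<open>S\<close>.\<close>
  have T: "T ** matrix_exp (- s *\<^sub>R vinberg_matrix a b c p q)
      = S ** matrix_exp ((1 - s) *\<^sub>R vinberg_matrix a b c p q)" for s
    using matrix_exp_scaleR_add[of 1 a b c p q "- s"]
    by (simp add: T_def flip: matrix_mul_assoc)
  have "vinberg_matrix (- a) (- b) (- c) (- p) (- q) = - vinberg_matrix a b c p q"
    by (simp add: vec_eq_iff forall_3)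
  then have "T ** matrix_exp (vinberg_matrix (- a) (- b) (- c) (- p) (- q)) = S"
    using T[of 1] by (simp add: matrix_exp_zero)
  moreover have "T \<in> vinberg_group"
    unfolding T_def by (intro vinberg_group_mult S matrix_exp_in_vinberg_group)
  ultimately have "cv_path (cholesky_map T) (cholesky_map S) t
      = cholesky_map (T ** matrix_exp (t *\<^sub>R vinberg_matrix (- a) (- b) (- c) (- p) (- q)))"
    using cv_path_exp by metis
  also have "\<dots> = cholesky_map (S ** matrix_exp ((1 - t) *\<^sub>R vinberg_matrix a b c p q))"
    using T[of t] by (simp add: vinberg_matrix_scaleR)
  finally show ?thesis unfolding S cv_path_exp[OF S(1)] T_def .
qed

lemma cv_path_scaleR:
  assumes "x \<in> vinberg_cone" "y \<in> vinberg_cone" "0 < l" "0 < m"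
  shows "cv_path (l *\<^sub>R x) (m *\<^sub>R y) t = (l powr (1 - t) * m powr t) *\<^sub>R cv_path x y t"
proof -
  obtain S a b c p q where S: "S \<in> vinberg_group" "x = cholesky_map S"
    "y = cholesky_map (S ** matrix_exp (vinberg_matrix a b c p q))"
    using vinberg_cone_pairE[OF assms(1,2)] .
  \<comment> \<open>Chosen so that \<open>m = l * exp (2 * r)\<close>: scaling \<open>x\<close> by
    \<open>l\<close> multiplies \<open>S\<close> by \<open>sqrt l\<close>, and the remaining factor
    on \<open>y\<close> adds \<open>r\<close> times the identity to \<open>Y\<close>.\<close>
  define r where "r = (ln m - ln l) / 2"
  have shift: "(sqrt l *\<^sub>R S) ** (exp u *\<^sub>R A) = (sqrt l * exp u) *\<^sub>R (S ** A)" for u A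
    by (simp add: vec_eq_iff matrix_matrix_mult_def sum_distrib_left mult_ac)
  have "2 * r = ln m - ln l" by (simp add: r_def)
  then have "m = l * exp (2 * r)" using assms by (simp add: exp_diff)
  then have "m *\<^sub>R y =
      cholesky_map ((sqrt l * exp r) *\<^sub>R (S ** matrix_exp (vinberg_matrix a b c p q)))"
    using assms by (simp add: cholesky_map_scaleR S power_mult_distrib exp_double)
  also have "\<dots> =
      cholesky_map ((sqrt l *\<^sub>R S) ** matrix_exp (vinberg_matrix (a + r) (b + r) (c + r) p q))"
    by (simp add: matrix_exp_add_scalar shift)
  finally have y: "m *\<^sub>R y = \<dots>" .
  have x: "l *\<^sub>R x = cholesky_map (sqrt l *\<^sub>R S)" using assms by (simp add: cholesky_map_scaleR S)
  have "sqrt l *\<^sub>R S \<in> vinberg_group" using S assms by (simp add: vinberg_group_scaleR)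
  then have "cv_path (l *\<^sub>R x) (m *\<^sub>R y) t = cholesky_map
      ((sqrt l *\<^sub>R S) ** matrix_exp (t *\<^sub>R vinberg_matrix (a + r) (b + r) (c + r) p q))"
    unfolding x y by (rule cv_path_exp)
  also have "matrix_exp (t *\<^sub>R vinberg_matrix (a + r) (b + r) (c + r) p q)
      = exp (t * r) *\<^sub>R matrix_exp (t *\<^sub>R vinberg_matrix a b c p q)"
    by (simp add: vinberg_matrix_scaleR distrib_left matrix_exp_add_scalar)
  also have "cholesky_map ((sqrt l *\<^sub>R S) ** \<dots>) = (l * exp (2 * (t * r))) *\<^sub>R cv_path x y t"
    unfolding S cv_path_exp[OF S(1)] shift cholesky_map_scaleR
    using assms by (simp add: power_mult_distrib exp_double)
  also have "l * exp (2 * (t * r)) = exp (ln l + 2 * (t * r))"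
    using assms by (simp add: exp_add)
  also have "\<dots> = l powr (1 - t) * m powr t"
    using assms by (simp add: powr_def r_def field_simps flip: exp_add)
  finally show ?thesis .
qed

lemma cv_path_equivariant:
  assumes "x \<in> vinberg_cone" "y \<in> vinberg_cone" "h \<in> vinberg_group"
  shows "cv_path (h ** x ** transpose h) (h ** y ** transpose h) t
    = h ** cv_path x y t ** transpose h"
proof -
  obtain S a b c p q where S: "S \<in> vinberg_group" "x = cholesky_map S"
    "y = cholesky_map (S ** matrix_exp (vinberg_matrix a b c p q))"
    using vinberg_cone_pairE[OF assms(1,2)] .
  have "h ** S \<in> vinberg_group" using assms S by (simp add: vinberg_group_mult)
  from cv_path_exp[OF this, of a b c p q t] show ?thesis
    unfolding S cv_path_exp[OF S(1)] cholesky_map_mult[symmetric] by (simp add: matrix_mul_assoc)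
qed

lemma det_cv_path:
  assumes "x \<in> vinberg_cone" "y \<in> vinberg_cone"
  shows "det (cv_path x y t) = det x powr (1 - t) * det y powr t"
proof -
  obtain S a b c p q where S: "S \<in> vinberg_group" "x = cholesky_map S"
    "y = cholesky_map (S ** matrix_exp (vinberg_matrix a b c p q))"
    using vinberg_cone_pairE[OF assms] .
  define D where "D = (det S)\<^sup>2"
  have "det S > 0" using S(1) by (auto simp: vinberg_group_iff det_vinberg_matrix)
  then have D: "D > 0" by (simp add: D_def)
  \<comment> \<open>The determinant of an exponential is the exponential of the trace, here
    \<open>a + b + c\<close>.\<close>
  have "det (S ** matrix_exp (u *\<^sub>R vinberg_matrix a b c p q))
      = det S * exp (u * (a + b + c))" for u
    by (simp add: det_mul vinberg_matrix_scaleR matrix_exp_vinberg_matrix det_vinberg_matrix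
        distrib_left exp_add)
  then have det: "det (cholesky_map (S ** matrix_exp (u *\<^sub>R vinberg_matrix a b c p q)))
      = D * exp (2 * (u * (a + b + c)))" for u
    by (simp add: det_cholesky_map power_mult_distrib D_def exp_double)
  have "det x = D" by (simp add: S det_cholesky_map D_def)
  moreover have "det y = D * exp (2 * (a + b + c))" using det[of 1] by (simp add: S)
  moreover have "det (cv_path x y t) = D * exp (2 * (t * (a + b + c)))"
    unfolding S cv_path_exp[OF S(1)] by (rule det)
  ultimately show ?thesis
    using D by (simp add: powr_mult powr_diff exp_powr_real mult_ac)
qed

text \<open>Justifies replacing the exponent \<open>1 / 2\<close> by \<open>sqrt\<close> in the
  determinant of the mean.\<close>

lemma det_vinberg_cone_pos: "x \<in> vinberg_cone \<Longrightarrow> 0 < det x"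
  by (metis det_cholesky_map vinberg_cone_cholesky vinberg_group_iff det_vinberg_matrix
      zero_less_power mult_pos_pos)

theorem theorem4p6:
  fixes x y :: "real^3^3" and t :: real
  assumes "x \<in> vinberg_cone" and "y \<in> vinberg_cone" and "0 \<le> t" and "t \<le> 1"
  shows "(cv_path x y 0 = x \<and> cv_path x y 1 = y \<and> cv_path y x t = cv_path x y (1 - t)
            \<and> cv_mean x y = cv_mean y x)
       \<and> (\<forall>l m :: real. 0 < l \<and> 0 < m \<longrightarrow>
            cv_path (l *\<^sub>R x) (m *\<^sub>R y) t = (l powr (1 - t) * m powr t) *\<^sub>R cv_path x y t
            \<and> cv_mean (l *\<^sub>R x) (m *\<^sub>R y) = sqrt (l * m) *\<^sub>R cv_mean x y)
       \<and> (\<forall>h \<in> vinberg_group.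
            cv_path (h ** x ** transpose h) (h ** y ** transpose h) t
              = h ** cv_path x y t ** transpose h
            \<and> cv_mean (h ** x ** transpose h) (h ** y ** transpose h)
              = h ** cv_mean x y ** transpose h)
       \<and> (det (cv_path x y t) = det x powr (1 - t) * det y powr t
            \<and> det (cv_mean x y) = sqrt (det x * det y))"
proof -
  note xy = assms(1,2)
  have "cv_mean (l *\<^sub>R x) (m *\<^sub>R y) = sqrt (l * m) *\<^sub>R cv_mean x y" if "0 < l" "0 < m" for l m
    using that cv_path_scaleR[OF xy that, of "1 / 2"]
    by (simp add: cv_mean_def powr_half_sqrt real_sqrt_mult)
  moreover have "det (cv_mean x y) = sqrt (det x * det y)"
    using det_cv_path[OF xy, of "1 / 2"] det_vinberg_cone_pos xy
    by (simp add: cv_mean_def powr_half_sqrt real_sqrt_mult less_imp_le)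
  moreover have "cv_mean x y = cv_mean y x"
    using cv_path_reverse[OF xy, of "1 / 2"] by (simp add: cv_mean_def)
  ultimately show ?thesis
    using cv_path_endpoints[OF xy] cv_path_reverse[OF xy] cv_path_scaleR[OF xy]
      cv_path_equivariant[OF xy] det_cv_path[OF xy] by (simp add: cv_mean_def)
qed

end
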